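(* Let the system (L) be jacobian, and let $\nu^\theta$, $\theta=1,\dots,m+1$, be common eigenvectors of the matrices $A_j$, $j=1,\dots,m$. Then the system (L) has the $\mathbb R$-differentiable first integral $$F\colon z\mapsto\prod_{\theta=1}^{m+1}\bigl(\nu^\theta\gamma\bigr)^{h_\theta}\quad\text{for all }z\in\Omega,\qquad \Omega\subset\mathrm D(F),$$ where $h_1,\dots,h_{m+1}$ is a nontrivial solution to the linear system $$\sum_{\theta=1}^{m+1}\lambda_\theta^j\,h_\theta=0,\quad j=1,\dots,m,$$ and $\lambda_\theta^j$ are the eigenvalues of the matrices $A_j$, $j=1,\dots,m$, corresponding to the common eigenvectors $\nu^\theta$, $\theta=1,\dots,m+1$, respectively.
   Context: System (L) is the linear homogeneous system of first-order partial differential equations $$\mathfrak L_j(z)w=0,\ j=1,\dots,m,\qquad \mathfrak L_j(z)=\sum_{\xi=1}^n\bigl(a_{j\xi}(z)\partial_{z_\xi}+a_{j,n+\xi}(z)\partial_{\overline z_\xi}\bigr),\ z\in\mathbb C^n,\tag{L}$$ with $\mathbb R$-linear coefficients $a_{jk}(z)=\sum_{\tau=1}^n(a_{jk\tau}z_\tau+a_{jk,n+\tau}\overline z_\tau)$, $a_{jkl}\in\mathbb C$, $k,l=1,\dots,2n$, $j=1,\dots,m$; $\partial_{z_\xi},\partial_{\overline z_\xi}$ are Wirtinger derivatives. The system is jacobian if all Poisson brackets (commutators) vanish: $[\mathfrak L_j(z),\mathfrak L_\zeta(z)]=0$ for all $z\in\mathbb C^n$, $j,\zeta=1,\dots,m$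 (equivalently $A_jA_\zeta=A_\zeta A_j$). $A_j$ is the $2n\times2n$ matrix whose entry in row $l$ and column $k$ is $a_{jkl}$, so that for a vector $b=(b_1,\dots,b_{2n})$ the function $p(z)=\sum_{\xi=1}^n(b_\xi z_\xi+b_{n+\xi}\overline z_\xi)$ satisfies $\mathfrak L_jp=\lambda p$ if and only if $(A_j-\lambda E)b=0$, $E$ being the identity matrix. For $\nu\in\mathbb C^{2n}$, $\nu\gamma=\sum_{\xi=1}^n(\nu_\xi z_\xi+\nu_{n+\xi}\overline z_\xi)$, where $\gamma=(z_1,\dots,z_n,\overline z_1,\dots,\overline z_n)^T$. An $\mathbb R$-differentiable function $F$ on a domain $\Omega\subset\mathbb C^n$ (differentiable as a function of real and imaginary parts) is a first integral of (L) if $\mathfrak L_jF=0$ on $\Omega$, $j=1,\dots,m$. $\mathrm D(F)$ is the domain of definition of $F$ (with branches of the powers chosen), and $\Omega$ is a domain contained in it. *)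

theory Defs
  imports "HOL-Analysis.Analysis"
begin

text \<open>
  Vectors in \<open>\<complex>\<^sup>2\<^sup>n\<close> and \<open>2n \<times> 2n\<close> matrices are indexed by the sum type \<open>'n + 'n\<close>: the index
  \<open>Inl \<xi>\<close> plays the role of \<open>\<xi>\<close> (it belongs to \<open>z\<^sub>\<xi>\<close>) and \<open>Inr \<xi>\<close> that of \<open>n + \<xi>\<close> (it belongs to
  the conjugate of \<open>z\<^sub>\<xi>\<close>).
\<close>

definition gamma :: "complex ^ 'n \<Rightarrow> complex ^ ('n + 'n)" where
  "gamma z = (\<chi> k. case k of Inl \<xi> \<Rightarrow> z $ \<xi> | Inr \<xi> \<Rightarrow> cnj (z $ \<xi>))"

definition linear_form :: "complex ^ ('n::finite + 'n) \<Rightarrow> complex ^ 'n \<Rightarrow> complex" where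
  "linear_form \<nu> z = (\<Sum>k\<in>UNIV. \<nu> $ k * gamma z $ k)"

definition partial_Re :: "'n \<Rightarrow> (complex ^ 'n \<Rightarrow> complex) \<Rightarrow> complex ^ 'n::finite \<Rightarrow> complex" where
  "partial_Re \<xi> F z = vector_derivative (\<lambda>t::real. F (z + t *\<^sub>R axis \<xi> 1)) (at 0)"

definition partial_Im :: "'n \<Rightarrow> (complex ^ 'n \<Rightarrow> complex) \<Rightarrow> complex ^ 'n::finite \<Rightarrow> complex" where
  "partial_Im \<xi> F z = vector_derivative (\<lambda>t::real. F (z + t *\<^sub>R axis \<xi> \<i>)) (at 0)"

definition wirtinger :: "'n \<Rightarrow> (complex ^ 'n \<Rightarrow> complex) \<Rightarrow> complex ^ 'n::finite \<Rightarrow> complex" where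
  "wirtinger \<xi> F z = (partial_Re \<xi> F z - \<i> * partial_Im \<xi> F z) / 2"

definition wirtinger_cnj :: "'n \<Rightarrow> (complex ^ 'n \<Rightarrow> complex) \<Rightarrow> complex ^ 'n::finite \<Rightarrow> complex" where
  "wirtinger_cnj \<xi> F z = (partial_Re \<xi> F z + \<i> * partial_Im \<xi> F z) / 2"

text \<open>
  The coefficients of a system are given by \<open>a j k l\<close>, the operators being numbered by natural
  numbers \<open>j \<in> {1..m}\<close>.
\<close>

definition coeff_fun ::
  "(nat \<Rightarrow> 'n + 'n \<Rightarrow> 'n + 'n \<Rightarrow> complex) \<Rightarrow> nat \<Rightarrow> 'n + 'n \<Rightarrow> complex ^ 'n::finite \<Rightarrow> complex" where
  "coeff_fun a j k z = (\<Sum>l\<in>UNIV. a j k l * gamma z $ l)"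

definition diff_op ::
  "(nat \<Rightarrow> 'n + 'n \<Rightarrow> 'n + 'n \<Rightarrow> complex) \<Rightarrow> nat \<Rightarrow> (complex ^ 'n \<Rightarrow> complex)
     \<Rightarrow> complex ^ 'n::finite \<Rightarrow> complex" where
  "diff_op a j F z =
     (\<Sum>\<xi>\<in>UNIV. coeff_fun a j (Inl \<xi>) z * wirtinger \<xi> F z
              + coeff_fun a j (Inr \<xi>) z * wirtinger_cnj \<xi> F z)"

text \<open>The row index is the last index of the coefficients, the column index the middle one.\<close>

definition coeff_matrix ::
  "(nat \<Rightarrow> 'n + 'n \<Rightarrow> 'n + 'n \<Rightarrow> complex) \<Rightarrow> nat \<Rightarrow> complex ^ ('n::finite + 'n) ^ ('n + 'n)" where
  "coeff_matrix a j = (\<chi> l k. a j k l)"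

definition C2_function :: "(complex ^ 'n::finite \<Rightarrow> complex) \<Rightarrow> bool" where
  "C2_function f \<longleftrightarrow>
     (\<exists>f' :: complex ^ 'n \<Rightarrow> ((complex ^ 'n) \<Rightarrow>\<^sub>L complex).
      \<exists>f'' :: complex ^ 'n \<Rightarrow> ((complex ^ 'n) \<Rightarrow>\<^sub>L ((complex ^ 'n) \<Rightarrow>\<^sub>L complex)).
        (\<forall>z. (f has_derivative blinfun_apply (f' z)) (at z)) \<and>
        (\<forall>z. (f' has_derivative blinfun_apply (f'' z)) (at z)) \<and>
        continuous_on UNIV f'')"

definition commutator ::
  "(nat \<Rightarrow> 'n + 'n \<Rightarrow> 'n + 'n \<Rightarrow> complex) \<Rightarrow> nat \<Rightarrow> nat \<Rightarrow> (complex ^ 'n \<Rightarrow> complex)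
     \<Rightarrow> complex ^ 'n::finite \<Rightarrow> complex" where
  "commutator a j \<zeta> f z = diff_op a j (diff_op a \<zeta> f) z - diff_op a \<zeta> (diff_op a j f) z"

text \<open>
  A commutator of operators is zero when it annihilates every function on which it is naturally
  defined, i.e. every (real) twice continuously differentiable one.
\<close>

definition jacobian_system ::
  "nat \<Rightarrow> (nat \<Rightarrow> 'n::finite + 'n \<Rightarrow> 'n + 'n \<Rightarrow> complex) \<Rightarrow> bool" where
  "jacobian_system m a \<longleftrightarrow>
     (\<forall>j\<in>{1..m}. \<forall>\<zeta>\<in>{1..m}. \<forall>f. C2_function f \<longrightarrow> (\<forall>z. commutator a j \<zeta> f z = 0))"

definition domain_set :: "'a::topological_space set \<Rightarrow> bool" where
  "domain_set \<Omega> \<longleftrightarrow> open \<Omega> \<and> connected \<Omega> \<and> \<Omega> \<noteq> {}"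

text \<open>The predicate \<open>differentiable\<close> means differentiability over the reals.\<close>

definition first_integral ::
  "nat \<Rightarrow> (nat \<Rightarrow> 'n + 'n \<Rightarrow> 'n + 'n \<Rightarrow> complex) \<Rightarrow> (complex ^ 'n::finite) set
     \<Rightarrow> (complex ^ 'n \<Rightarrow> complex) \<Rightarrow> bool" where
  "first_integral m a \<Omega> F \<longleftrightarrow>
     (\<forall>z\<in>\<Omega>. F differentiable (at z)) \<and> (\<forall>j\<in>{1..m}. \<forall>z\<in>\<Omega>. diff_op a j F z = 0)"

definition common_eigenvector ::
  "nat \<Rightarrow> (nat \<Rightarrow> 'n + 'n \<Rightarrow> 'n + 'n \<Rightarrow> complex) \<Rightarrow> complex ^ ('n::finite + 'n)
     \<Rightarrow> (nat \<Rightarrow> complex) \<Rightarrow> bool" where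
  "common_eigenvector m a \<nu> lam \<longleftrightarrow>
     \<nu> \<noteq> 0 \<and> (\<forall>j\<in>{1..m}. coeff_matrix a j *v \<nu> = lam j *s \<nu>)"

text \<open>
  All values of the multivalued power \<open>w\<^sup>h\<close>: they are \<open>exp (h * l)\<close> for the logarithms \<open>l\<close> of \<open>w\<close>.
  For a natural exponent this is the usual power, which is also defined at \<open>w = 0\<close>; for all other
  exponents there is no value at \<open>w = 0\<close>.
\<close>

definition power_values :: "complex \<Rightarrow> complex \<Rightarrow> complex set" where
  "power_values w h = {exp (h * l) | l. exp l = w} \<union> {w ^ k | k :: nat. h = of_nat k}"

definition power_branch_on ::
  "'a::topological_space set \<Rightarrow> ('a \<Rightarrow> complex) \<Rightarrow> complex \<Rightarrow> ('a \<Rightarrow> complex) \<Rightarrow> bool" where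
  "power_branch_on D w h P \<longleftrightarrow> continuous_on D P \<and> (\<forall>z\<in>D. P z \<in> power_values (w z) h)"

text \<open>
  \<open>F\<close> is, with domain of definition \<open>D\<close> and for some choice of branches of the powers on \<open>D\<close>, the
  product of the \<open>h\<^sub>\<theta>\<close>-th powers of the linear forms \<open>\<nu>\<^sup>\<theta>\<gamma>\<close>, \<open>\<theta> = 1, \<dots>, m + 1\<close>.
\<close>

definition power_product_on ::
  "nat \<Rightarrow> (complex ^ 'n::finite) set \<Rightarrow> (nat \<Rightarrow> complex ^ ('n + 'n)) \<Rightarrow> (nat \<Rightarrow> complex)
     \<Rightarrow> (complex ^ 'n \<Rightarrow> complex) \<Rightarrow> bool" where
  "power_product_on m D \<nu> h F \<longleftrightarrow>
     (\<exists>P. (\<forall>\<theta>\<in>{1..m+1}. power_branch_on D (linear_form (\<nu> \<theta>)) (h \<theta>) (P \<theta>)) \<and>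
          (\<forall>z\<in>D. F z = (\<Prod>\<theta>=1..m+1. P \<theta> z)))"

definition nontrivial_solution :: "nat \<Rightarrow> (nat \<Rightarrow> nat \<Rightarrow> complex) \<Rightarrow> (nat \<Rightarrow> complex) \<Rightarrow> bool" where
  "nontrivial_solution m lam h \<longleftrightarrow>
     (\<exists>\<theta>\<in>{1..m+1}. h \<theta> \<noteq> 0) \<and> (\<forall>j\<in>{1..m}. (\<Sum>\<theta>=1..m+1. lam \<theta> j * h \<theta>) = 0)"

end

theory Submission
  imports Defs
begin

text \<open>
  A function \<open>G\<close> with \<open>L\<^sub>j G = c G\<close> is an eigenfunction of the operator \<open>L\<^sub>j\<close>. Each operator \<open>L\<^sub>j\<close> is a
  derivation, so eigenvalues add up when eigenfunctions are multiplied, and by the chain rule a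
  branch of \<open>w\<^sup>h\<close> has the eigenvalue \<open>h \<lambda>\<close> if \<open>w\<close> has the eigenvalue \<open>\<lambda>\<close>, because
  \<open>w (w\<^sup>h)' = h w\<^sup>h\<close>. An eigenvector of \<open>A\<^sub>j\<close> is precisely the coefficient vector of a linear
  eigenfunction (\<open>diff_op_linear_form_eigenvector\<close>). Hence \<open>F\<close> is an eigenfunction of \<open>L\<^sub>j\<close> with
  eigenvalue \<open>\<Sum>\<^sub>\<theta> \<lambda>\<^sub>\<theta>\<^sup>j h\<^sub>\<theta>\<close>, and the linear system for \<open>h\<close> says that all these eigenvalues are zero.
  It consists of \<open>m\<close> homogeneous equations in \<open>m + 1\<close> unknowns and therefore has a nontrivial
  solution.

  Two points need care. First, a branch \<open>P\<close> of the power is only assumed to be continuous; near a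
  point with \<open>w \<noteq> 0\<close> it is compared with the branch given by the principal logarithm, and their
  quotient is continuous with values in a countable set, hence constant on a ball
  (\<open>power_branch_locally_analytic\<close>). Where \<open>w = 0\<close>, a value of the power exists only for a natural
  exponent, and then \<open>P\<close> is the polynomial \<open>w\<^sup>k\<close>. Second, there has to be a domain on which all the
  powers have branches: a small ball around a point at which none of the linear forms vanishes. Such
  a point exists because the zero set of each of the finitely many forms is a proper real subspace,
  which is a null set.
\<close>

section \<open>Underdetermined homogeneous linear systems\<close>

text \<open>
  Gaussian elimination: an equation with a nonzero coefficient at \<open>\<theta>\<^sub>0\<close> is solved for the unknown \<open>\<theta>\<^sub>0\<close>,
  which leaves one equation fewer and one unknown fewer.
\<close>

lemma underdetermined_system_has_nontrivial_solution:
  fixes c :: "nat \<Rightarrow> 'b \<Rightarrow> 'c::field"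
  assumes "finite T" "m < card T"
  shows "\<exists>h. (\<exists>\<theta>\<in>T. h \<theta> \<noteq> 0) \<and> (\<forall>j\<in>{1..m}. (\<Sum>\<theta>\<in>T. c j \<theta> * h \<theta>) = 0)"
  using assms
proof (induction m arbitrary: T c)
  case 0
  then obtain \<theta> where "\<theta> \<in> T" by fastforce
  then show ?case by (intro exI[of _ "\<lambda>_. 1"]) auto
next
  case (Suc m)
  show ?case
  proof (cases "\<forall>\<theta>\<in>T. c (Suc m) \<theta> = 0")
    case True
    have "m < card T" using Suc.prems by simp
    then obtain h where h: "\<exists>\<theta>\<in>T. h \<theta> \<noteq> 0" "\<forall>j\<in>{1..m}. (\<Sum>\<theta>\<in>T. c j \<theta> * h \<theta>) = 0"
      using Suc.IH[OF Suc.prems(1)] by metis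
    have "(\<Sum>\<theta>\<in>T. c (Suc m) \<theta> * h \<theta>) = 0" using True by simp
    with h show ?thesis by (intro exI[of _ h]) (auto simp: le_Suc_eq)
  next
    case False
    then obtain \<theta>\<^sub>0 where \<theta>\<^sub>0: "\<theta>\<^sub>0 \<in> T" "c (Suc m) \<theta>\<^sub>0 \<noteq> 0" by blast
    define T' where "T' = T - {\<theta>\<^sub>0}"
    define p where "p \<theta> = c (Suc m) \<theta> / c (Suc m) \<theta>\<^sub>0" for \<theta>
    have T': "finite T'" "m < card T'" "\<theta>\<^sub>0 \<notin> T'" "T = insert \<theta>\<^sub>0 T'"
      using Suc.prems \<theta>\<^sub>0 by (auto simp: T'_def)
    obtain g where g: "\<exists>\<theta>\<in>T'. g \<theta> \<noteq> 0"
      "\<forall>j\<in>{1..m}. (\<Sum>\<theta>\<in>T'. (c j \<theta> - c j \<theta>\<^sub>0 * p \<theta>) * g \<theta>) = 0"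
      using Suc.IH[OF T'(1,2), of "\<lambda>j \<theta>. c j \<theta> - c j \<theta>\<^sub>0 * p \<theta>"] by auto
    define s where "s = (\<Sum>\<theta>\<in>T'. p \<theta> * g \<theta>)"
    define h where "h = g(\<theta>\<^sub>0 := - s)"
    have sum_h: "(\<Sum>\<theta>\<in>T. c j \<theta> * h \<theta>) = (\<Sum>\<theta>\<in>T'. c j \<theta> * g \<theta>) - c j \<theta>\<^sub>0 * s" for j
    proof -
      have "(\<Sum>\<theta>\<in>T'. c j \<theta> * h \<theta>) = (\<Sum>\<theta>\<in>T'. c j \<theta> * g \<theta>)"
        using T'(3) by (intro sum.cong) (auto simp: h_def)
      then show ?thesis using T' by (simp add: h_def)
    qed
    have "(\<Sum>\<theta>\<in>T. c (Suc m) \<theta> * h \<theta>) = 0"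
      unfolding sum_h using \<theta>\<^sub>0(2) by (simp add: s_def p_def sum_distrib_left)
    moreover have "(\<Sum>\<theta>\<in>T. c j \<theta> * h \<theta>) = 0" if "j \<in> {1..m}" for j
      unfolding sum_h using g(2) that
      by (simp add: s_def sum_distrib_left left_diff_distrib sum_subtractf mult.assoc)
    moreover have "\<exists>\<theta>\<in>T. h \<theta> \<noteq> 0"
      using g(1) T'(3,4) by (auto simp: h_def)
    ultimately show ?thesis by (intro exI[of _ h]) (auto simp: le_Suc_eq)
  qed
qed

section \<open>The operators as derivations\<close>

text \<open>
  The value of the operator at a point is a complex linear function of the total derivative, so that
  all differentiation rules reduce to those for \<open>has_derivative\<close>.
\<close>

definition derivative_pairing ::
  "(nat \<Rightarrow> 'n + 'n \<Rightarrow> 'n + 'n \<Rightarrow> complex) \<Rightarrow> nat \<Rightarrow> complex ^ 'n::finite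
     \<Rightarrow> (complex ^ 'n \<Rightarrow> complex) \<Rightarrow> complex" where
  "derivative_pairing a j z F' =
     (\<Sum>\<xi>\<in>UNIV. coeff_fun a j (Inl \<xi>) z * ((F' (axis \<xi> 1) - \<i> * F' (axis \<xi> \<i>)) / 2)
              + coeff_fun a j (Inr \<xi>) z * ((F' (axis \<xi> 1) + \<i> * F' (axis \<xi> \<i>)) / 2))"

lemma directional_vector_derivative:
  fixes F :: "'a::real_normed_vector \<Rightarrow> 'b::real_normed_vector"
  assumes "(F has_derivative F') (at z)"
  shows "vector_derivative (\<lambda>t::real. F (z + t *\<^sub>R v)) (at 0) = F' v"
proof (rule vector_derivative_at)
  have "((\<lambda>t::real. z + t *\<^sub>R v) has_derivative (\<lambda>t. t *\<^sub>R v)) (at 0)"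
    by (auto intro!: derivative_eq_intros)
  moreover have "(F has_derivative F') (at (z + 0 *\<^sub>R v))" using assms by simp
  ultimately have "((\<lambda>t::real. F (z + t *\<^sub>R v)) has_derivative (\<lambda>t. F' (t *\<^sub>R v))) (at 0)"
    by (rule has_derivative_compose)
  moreover have "linear F'" using assms by (rule has_derivative_linear)
  ultimately show "((\<lambda>t::real. F (z + t *\<^sub>R v)) has_vector_derivative F' v) (at 0)"
    by (simp add: has_vector_derivative_def linear_cmul)
qed

lemma diff_op_eq_derivative_pairing:
  assumes "(F has_derivative F') (at z)"
  shows "diff_op a j F z = derivative_pairing a j z F'"
  unfolding diff_op_def derivative_pairing_def wirtinger_def wirtinger_cnj_def partial_Re_def
    partial_Im_def directional_vector_derivative[OF assms] ..

lemma derivative_pairing_add: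
  "derivative_pairing a j z (\<lambda>v. F v + G v) = derivative_pairing a j z F + derivative_pairing a j z G"
  unfolding derivative_pairing_def sum.distrib[symmetric]
  by (intro sum.cong refl) (simp add: field_simps)

lemma derivative_pairing_cmult:
  "derivative_pairing a j z (\<lambda>v. c * F v) = c * derivative_pairing a j z F"
  unfolding derivative_pairing_def sum_distrib_left
  by (intro sum.cong refl) (simp add: field_simps)

lemma diff_op_mult:
  assumes "F differentiable (at z)" "G differentiable (at z)"
  shows "diff_op a j (\<lambda>y. F y * G y) z = F z * diff_op a j G z + diff_op a j F z * G z"
proof -
  obtain F' G' where *: "(F has_derivative F') (at z)" "(G has_derivative G') (at z)"
    using assms by (auto simp: differentiable_def)
  have "((\<lambda>y. F y * G y) has_derivative (\<lambda>v. F z * G' v + G z * F' v)) (at z)"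
    using has_derivative_mult[OF *] by (simp add: mult.commute)
  from diff_op_eq_derivative_pairing[OF this] show ?thesis
    unfolding derivative_pairing_add derivative_pairing_cmult
      diff_op_eq_derivative_pairing[OF *(1)] diff_op_eq_derivative_pairing[OF *(2)]
    by (simp add: mult.commute)
qed

lemma diff_op_chain:
  assumes "(g has_field_derivative d) (at (w z))" "w differentiable (at z)"
  shows "(\<lambda>y. g (w y)) differentiable (at z)"
    and "diff_op a j (\<lambda>y. g (w y)) z = d * diff_op a j w z"
proof -
  obtain w' where w': "(w has_derivative w') (at z)"
    using assms(2) by (auto simp: differentiable_def)
  have "((\<lambda>y. g (w y)) has_derivative (\<lambda>v. d * w' v)) (at z)"
    using has_derivative_compose[OF w' assms(1)[unfolded has_field_derivative_def]] .
  then show "(\<lambda>y. g (w y)) differentiable (at z)"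
    and "diff_op a j (\<lambda>y. g (w y)) z = d * diff_op a j w z"
    using w' by (auto simp: differentiable_def diff_op_eq_derivative_pairing
        derivative_pairing_cmult)
qed

lemma diff_op_local:
  assumes "open S" "z \<in> S" "\<And>y. y \<in> S \<Longrightarrow> F y = G y" "G differentiable (at z)"
  shows "F differentiable (at z)" and "diff_op a j F z = diff_op a j G z"
proof -
  obtain G' where G': "(G has_derivative G') (at z)"
    using assms(4) by (auto simp: differentiable_def)
  then have "(F has_derivative G') (at z)"
    by (rule has_derivative_transform_within_open[OF _ assms(1,2)]) (use assms(3) in simp)
  with G' show "F differentiable (at z)" and "diff_op a j F z = diff_op a j G z"
    by (auto simp: differentiable_def diff_op_eq_derivative_pairing)
qed

lemma differentiable_prod:
  fixes P :: "'b \<Rightarrow> 'a::real_normed_vector \<Rightarrow> complex"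
  assumes "\<And>\<theta>. \<theta> \<in> T \<Longrightarrow> P \<theta> differentiable (at z)"
  shows "(\<lambda>y. \<Prod>\<theta>\<in>T. P \<theta> y) differentiable (at z)"
proof -
  from assms have "\<forall>\<theta>\<in>T. \<exists>P'. (P \<theta> has_derivative P') (at z)"
    by (simp add: differentiable_def)
  then obtain P' where "\<forall>\<theta>\<in>T. (P \<theta> has_derivative P' \<theta>) (at z)" by metis
  then show ?thesis
    unfolding differentiable_def using has_derivative_prod[of T P P' z UNIV] by blast
qed

lemma diff_op_prod_eigenfunctions:
  assumes "finite T" "\<And>\<theta>. \<theta> \<in> T \<Longrightarrow> P \<theta> differentiable (at z)"
    and "\<And>\<theta>. \<theta> \<in> T \<Longrightarrow> diff_op a j (P \<theta>) z = c \<theta> * P \<theta> z"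
  shows "diff_op a j (\<lambda>y. \<Prod>\<theta>\<in>T. P \<theta> y) z = (\<Sum>\<theta>\<in>T. c \<theta>) * (\<Prod>\<theta>\<in>T. P \<theta> z)"
  using assms
proof (induction T)
  case empty
  have "((\<lambda>_. 1 :: complex) has_derivative (\<lambda>_. 0)) (at z)" by simp
  from diff_op_eq_derivative_pairing[OF this] have "diff_op a j (\<lambda>_. 1) z = 0"
    by (simp add: derivative_pairing_def)
  then show ?case by simp
next
  case (insert \<theta> T)
  then have "P \<theta> differentiable (at z)" "(\<lambda>y. \<Prod>\<theta>\<in>T. P \<theta> y) differentiable (at z)"
    by (auto intro: differentiable_prod)
  from diff_op_mult[OF this, of a j] insert show ?case by (simp add: algebra_simps)
qed

section \<open>Linear forms\<close>

lemma sum_UNIV_sum_type: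
  fixes f :: "'a::finite + 'b::finite \<Rightarrow> 'c::comm_monoid_add"
  shows "(\<Sum>k\<in>UNIV. f k) = (\<Sum>\<xi>\<in>UNIV. f (Inl \<xi>)) + (\<Sum>\<xi>\<in>UNIV. f (Inr \<xi>))"
  unfolding UNIV_sum by (subst sum.union_disjoint) (auto simp: sum.reindex)

lemma linear_form_eq:
  "linear_form \<nu> z = (\<Sum>\<xi>\<in>UNIV. \<nu> $ Inl \<xi> * z $ \<xi> + \<nu> $ Inr \<xi> * cnj (z $ \<xi>))"
  by (simp add: linear_form_def gamma_def sum_UNIV_sum_type sum.distrib)

lemma linear_linear_form: "linear (linear_form \<nu>)"
proof (rule linearI)
  show "linear_form \<nu> (x + y) = linear_form \<nu> x + linear_form \<nu> y" for x y
    unfolding linear_form_eq sum.distrib[symmetric]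
    by (intro sum.cong refl) (simp add: algebra_simps)
  show "linear_form \<nu> (r *\<^sub>R x) = r *\<^sub>R linear_form \<nu> x" for r x
    unfolding linear_form_eq scaleR_sum_right
    by (intro sum.cong refl) (simp add: algebra_simps)
qed

lemma linear_form_has_derivative: "(linear_form \<nu> has_derivative linear_form \<nu>) (at z)"
  by (intro bounded_linear_imp_has_derivative linear_conv_bounded_linear[THEN iffD1]
      linear_linear_form)

lemma continuous_on_linear_form: "continuous_on S (linear_form \<nu>)"
  by (intro linear_continuous_on linear_conv_bounded_linear[THEN iffD1] linear_linear_form)

lemma linear_form_axis: "linear_form \<nu> (axis \<xi> u) = \<nu> $ Inl \<xi> * u + \<nu> $ Inr \<xi> * cnj u"
proof -
  have "linear_form \<nu> (axis \<xi> u) = (\<Sum>\<eta>\<in>UNIV. if \<eta> = \<xi> then \<nu> $ Inl \<xi> * u + \<nu> $ Inr \<xi> * cnj u else 0)"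
    unfolding linear_form_eq by (intro sum.cong refl) (auto simp: axis_def)
  then show ?thesis by simp
qed

text \<open>
  The Wirtinger derivatives of a linear form are its coefficients, so the operator acts on the
  coefficient vector as the matrix does.
\<close>

lemma diff_op_linear_form:
  "diff_op a j (linear_form \<nu>) z = linear_form (coeff_matrix a j *v \<nu>) z"
proof -
  have "diff_op a j (linear_form \<nu>) z = (\<Sum>k\<in>UNIV. coeff_fun a j k z * \<nu> $ k)"
    unfolding diff_op_eq_derivative_pairing[OF linear_form_has_derivative] derivative_pairing_def
      linear_form_axis sum_UNIV_sum_type sum.distrib[symmetric]
    by (intro sum.cong refl) (simp add: algebra_simps)
  also have "\<dots> = (\<Sum>k\<in>UNIV. \<Sum>l\<in>UNIV. a j k l * \<nu> $ k * gamma z $ l)"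
    unfolding coeff_fun_def sum_distrib_right by (intro sum.cong refl) (simp add: algebra_simps)
  also have "\<dots> = (\<Sum>l\<in>UNIV. \<Sum>k\<in>UNIV. a j k l * \<nu> $ k * gamma z $ l)"
    by (rule sum.swap)
  also have "\<dots> = linear_form (coeff_matrix a j *v \<nu>) z"
    unfolding linear_form_def matrix_vector_mult_def coeff_matrix_def
    by (simp add: sum_distrib_right)
  finally show ?thesis .
qed

lemma diff_op_linear_form_eigenvector:
  assumes "coeff_matrix a j *v \<nu> = c *s \<nu>"
  shows "diff_op a j (linear_form \<nu>) z = c * linear_form \<nu> z"
  unfolding diff_op_linear_form assms
  by (simp add: linear_form_def vector_scalar_mult_def sum_distrib_left mult.assoc)

text \<open>
  The values at \<open>axis \<xi> 1\<close> and \<open>axis \<xi> \<i>\<close> are \<open>\<nu>\<^sub>\<xi> + \<nu>\<^sub>n\<^sub>+\<^sub>\<xi>\<close> and \<open>\<i> (\<nu>\<^sub>\<xi> - \<nu>\<^sub>n\<^sub>+\<^sub>\<xi>)\<close>, which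
  determine both coefficients.
\<close>

lemma linear_form_not_identically_zero:
  assumes "\<nu> \<noteq> 0"
  shows "\<exists>z. linear_form \<nu> z \<noteq> 0"
proof (rule ccontr)
  assume "\<nexists>z. linear_form \<nu> z \<noteq> 0"
  then have zero: "linear_form \<nu> z = 0" for z by blast
  have "\<nu> $ Inl \<xi> = 0 \<and> \<nu> $ Inr \<xi> = 0" for \<xi>
    using zero[of "axis \<xi> 1"] zero[of "axis \<xi> \<i>"] by (auto simp: linear_form_axis)
  then have "\<nu> $ k = 0" for k by (cases k) auto
  with assms show False by (simp add: vec_eq_iff)
qed

lemma linear_forms_common_nonzero:
  fixes \<nu> :: "'b \<Rightarrow> complex ^ ('n::finite + 'n)"
  assumes "finite T" "\<And>\<theta>. \<theta> \<in> T \<Longrightarrow> \<nu> \<theta> \<noteq> 0"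
  shows "\<exists>z. \<forall>\<theta>\<in>T. linear_form (\<nu> \<theta>) z \<noteq> 0"
proof -
  define N where "N \<theta> = {z. linear_form (\<nu> \<theta>) z = 0}" for \<theta>
  have "negligible (N \<theta>)" if "\<theta> \<in> T" for \<theta>
  proof (rule negligible_lowdim)
    have "subspace (N \<theta>)"
      unfolding N_def by (rule linear_subspace_kernel[OF linear_linear_form])
    moreover have "N \<theta> \<noteq> UNIV"
      using linear_form_not_identically_zero[OF assms(2)[OF that]] by (auto simp: N_def)
    ultimately have "span (N \<theta>) \<noteq> UNIV" by (simp add: span_eq_iff[THEN iffD2])
    then show "dim (N \<theta>) < DIM(complex ^ 'n)"
      using dim_eq_full dim_subset_UNIV le_neq_implies_less by blast
  qed
  with assms(1) have "negligible (\<Union> (N ` T))" by (intro negligible_Union) auto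
  then have "\<Union> (N ` T) \<noteq> UNIV" by auto
  then show ?thesis by (auto simp: N_def)
qed

section \<open>Branches of powers\<close>

lemma power_values_nonzero:
  assumes "w \<noteq> 0"
  shows "power_values w h = {exp (h * l) | l. exp l = w}"
proof -
  have "\<exists>l. w ^ k = exp (of_nat k * l) \<and> exp l = w" for k
    using assms by (intro exI[of _ "Ln w"]) (simp add: exp_of_nat_mult)
  then show ?thesis by (auto simp: power_values_def)
qed

lemma power_values_of_nat: "power_values w (of_nat k) = {w ^ k}"
  by (auto simp: power_values_def exp_of_nat_mult)

lemma power_values_at_0_imp_nat:
  assumes "p \<in> power_values 0 h"
  obtains k :: nat where "h = of_nat k"
  using assms by (auto simp: power_values_def)

lemma divide_right_half_plane_nonpos_Reals:
  assumes "0 < Re (u / u\<^sub>0)"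
  shows "u / u\<^sub>0 \<notin> \<real>\<^sub>\<le>\<^sub>0"
  using assms by (auto simp: complex_nonpos_Reals_iff)

text \<open>
  On a ball around \<open>z\<close> on which \<open>w / w z\<close> stays in the right half-plane, dividing \<open>P\<close> by
  \<open>exp (h * Ln (w / w z))\<close> leaves a continuous function whose values belong to the countable set of
  values of the power at \<open>w z\<close>.
\<close>

lemma power_branch_locally_principal:
  fixes w :: "'a::real_normed_vector \<Rightarrow> complex"
  assumes "power_branch_on S w h P" "open S" "z \<in> S" "continuous_on S w" "w z \<noteq> 0"
  obtains e where "0 < e" "\<And>y. y \<in> ball z e \<Longrightarrow> P y = P z * exp (h * Ln (w y / w z))"
proof -
  define U where "U = S \<inter> (\<lambda>y. w y / w z) -` {u. 0 < Re u}"
  have "continuous_on S (\<lambda>y. w y / w z)"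
    using assms(4,5) by (intro continuous_intros) auto
  then have "open U"
    unfolding U_def using continuous_open_preimage[OF _ assms(2) open_halfspace_Re_gt] by blast
  moreover have "z \<in> U" using assms(3,5) by (simp add: U_def)
  ultimately obtain e where e: "0 < e" "ball z e \<subseteq> U" by (meson open_contains_ball)
  define Q where "Q y = P y / exp (h * Ln (w y / w z))" for y
  have "continuous_on (ball z e) Q"
  proof -
    have "ball z e \<subseteq> S" using e(2) by (auto simp: U_def)
    moreover from assms(1) have "continuous_on S P" by (simp add: power_branch_on_def)
    ultimately have *: "continuous_on (ball z e) P" "continuous_on (ball z e) w"
      using assms(4) continuous_on_subset by blast+
    have "w y / w z \<notin> \<real>\<^sub>\<le>\<^sub>0" if "y \<in> ball z e" for y
      using e(2) that by (intro divide_right_half_plane_nonpos_Reals) (auto simp: U_def)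
    then show ?thesis
      unfolding Q_def using assms(5) by (intro continuous_intros *) auto
  qed
  then have connected: "connected (Q ` ball z e)"
    by (rule connected_continuous_image) simp
  have "Q ` ball z e \<subseteq> (\<lambda>n::int. exp (h * (Ln (w z) + of_int (2 * n) * pi * \<i>))) ` UNIV"
  proof (rule image_subsetI)
    fix y assume "y \<in> ball z e"
    then have y: "y \<in> S" "w y \<noteq> 0" using e(2) by (auto simp: U_def)
    then have "P y \<in> power_values (w y) h" using assms(1) by (simp add: power_branch_on_def)
    then obtain l where l: "P y = exp (h * l)" "exp l = w y"
      unfolding power_values_nonzero[OF y(2)] by auto
    have "exp l = exp (Ln (w y / w z) + Ln (w z))"
      using y(2) assms(5) l(2) by (simp add: exp_add)
    then obtain n :: int where "l = Ln (w y / w z) + Ln (w z) + of_int (2 * n) * pi * \<i>"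
      unfolding exp_eq by auto
    then have "Q y = exp (h * (Ln (w z) + of_int (2 * n) * pi * \<i>))"
      by (simp add: Q_def l(1) exp_diff[symmetric] algebra_simps)
    then show "Q y \<in> range (\<lambda>n::int. exp (h * (Ln (w z) + of_int (2 * n) * pi * \<i>)))" by blast
  qed
  then have "countable (Q ` ball z e)"
    by (rule countable_subset) auto
  then have "Q y = Q z" if "y \<in> ball z e" for y
    using connected_uncountable[OF connected, of "Q y" "Q z"] that e(1) by auto
  moreover have "Q z = P z" using assms(5) by (simp add: Q_def)
  ultimately have "P y = P z * exp (h * Ln (w y / w z))" if "y \<in> ball z e" for y
    using that by (auto simp: Q_def divide_eq_eq)
  with e(1) show thesis by (rule that)
qed

text \<open>
  The relation \<open>d * w z = h * P z\<close> is the form of \<open>d = h * P z / w z\<close> that survives at a zero of \<open>w\<close>.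
  There the exponent \<open>h\<close> is a natural number, and both sides vanish: the right-hand side because
  \<open>h = 0\<close> or \<open>P z = 0 ^ h = 0\<close>.
\<close>

lemma power_branch_locally_analytic:
  fixes w :: "'a::real_normed_vector \<Rightarrow> complex"
  assumes "power_branch_on S w h P" "open S" "z \<in> S" "continuous_on S w"
  obtains U g d where "open U" "z \<in> U" "\<And>y. y \<in> U \<Longrightarrow> P y = g (w y)"
    "(g has_field_derivative d) (at (w z))" "d * w z = h * P z"
proof (cases "w z = 0")
  case True
  have "P z \<in> power_values 0 h" using assms(1,3) True by (auto simp: power_branch_on_def)
  then obtain k :: nat where k: "h = of_nat k" by (rule power_values_at_0_imp_nat)
  have P: "P y = w y ^ k" if "y \<in> S" for y
    using assms(1) that by (auto simp: power_branch_on_def k power_values_of_nat)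
  have "((\<lambda>u. u ^ k) has_field_derivative of_nat k * w z ^ (k - 1)) (at (w z))"
    by (auto intro!: derivative_eq_intros)
  moreover have "of_nat k * w z ^ (k - 1) * w z = h * P z"
    using assms(3) by (cases k) (simp_all add: P k)
  ultimately show thesis by (intro that[OF assms(2,3) P])
next
  case False
  obtain e where e: "0 < e" "\<And>y. y \<in> ball z e \<Longrightarrow> P y = P z * exp (h * Ln (w y / w z))"
    by (rule power_branch_locally_principal[OF assms False]) (rule that)
  show thesis
  proof (rule that)
    show "open (ball z e)" "z \<in> ball z e" using e(1) by auto
    show "P y = (\<lambda>u. P z * exp (h * Ln (u / w z))) (w y)" if "y \<in> ball z e" for y
      using e(2)[OF that] by simp
    have "w z / w z \<notin> \<real>\<^sub>\<le>\<^sub>0"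
      using False by (intro divide_right_half_plane_nonpos_Reals) simp
    then show "((\<lambda>u. P z * exp (h * Ln (u / w z))) has_field_derivative h * P z / w z) (at (w z))"
      using False by (auto intro!: derivative_eq_intros)
    show "h * P z / w z * w z = h * P z" using False by simp
  qed
qed

lemma diff_op_power_branch:
  assumes "power_branch_on S w h P" "open S" "z \<in> S" "continuous_on S w"
    and "w differentiable (at z)"
  shows "P differentiable (at z)"
    and "diff_op a j w z = c * w z \<Longrightarrow> diff_op a j P z = (c * h) * P z"
proof -
  obtain U g d where *: "open U" "z \<in> U" "\<And>y. y \<in> U \<Longrightarrow> P y = g (w y)"
    "(g has_field_derivative d) (at (w z))" and d: "d * w z = h * P z"
    using power_branch_locally_analytic[OF assms(1-4)] by blast
  note chain = diff_op_chain[OF *(4) assms(5)]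
  show "P differentiable (at z)" by (rule diff_op_local(1)[OF *(1-3) chain(1)])
  assume "diff_op a j w z = c * w z"
  then have "diff_op a j P z = c * (d * w z)"
    by (simp add: diff_op_local(2)[OF *(1-3) chain(1)] chain(2))
  then show "diff_op a j P z = (c * h) * P z" unfolding d by simp
qed

text \<open>
  The principal logarithm of \<open>w\<close> itself may jump if \<open>w z\<close> is a negative real number; that of the
  quotient \<open>w / w z\<close> does not.
\<close>

lemma power_branch_exists_near:
  fixes w :: "'a::topological_space \<Rightarrow> complex"
  assumes "continuous_on S w" "w z \<noteq> 0" "\<And>y. y \<in> S \<Longrightarrow> 0 < Re (w y / w z)"
  shows "power_branch_on S w h (\<lambda>y. exp (h * (Ln (w z) + Ln (w y / w z))))"
  unfolding power_branch_on_def
proof (intro conjI ballI)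
  show "continuous_on S (\<lambda>y. exp (h * (Ln (w z) + Ln (w y / w z))))"
    using divide_right_half_plane_nonpos_Reals[OF assms(3)] assms(2)
    by (intro continuous_intros assms(1)) auto
next
  fix y assume "y \<in> S"
  then have "w y \<noteq> 0" using assms(3) by fastforce
  then have "exp (Ln (w z) + Ln (w y / w z)) = w y" using assms(2) by (simp add: exp_add)
  then show "exp (h * (Ln (w z) + Ln (w y / w z))) \<in> power_values (w y) h"
    by (auto simp: power_values_def)
qed

section \<open>Products of powers of linear forms\<close>

lemma power_product_exists:
  fixes \<nu> :: "nat \<Rightarrow> complex ^ ('n::finite + 'n)"
  assumes "\<And>\<theta>. \<theta> \<in> {1..m+1} \<Longrightarrow> \<nu> \<theta> \<noteq> 0"
  shows "\<exists>F D. power_product_on m D \<nu> h F \<and> domain_set D"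
proof -
  obtain z where z: "\<forall>\<theta>\<in>{1..m+1}. linear_form (\<nu> \<theta>) z \<noteq> 0"
    using linear_forms_common_nonzero[of "{1..m+1}" \<nu>] assms by blast
  define H where "H \<theta> = (\<lambda>y. linear_form (\<nu> \<theta>) y / linear_form (\<nu> \<theta>) z) -` {u. 0 < Re u}" for \<theta>
  have "open (\<Inter>\<theta>\<in>{1..m+1}. H \<theta>)"
  proof (intro open_INT finite_atLeastAtMost ballI)
    fix \<theta> assume "\<theta> \<in> {1..m+1}"
    then show "open (H \<theta>)"
      unfolding H_def using z
      by (intro open_vimage open_halfspace_Re_gt continuous_intros continuous_on_linear_form) auto
  qed
  moreover have "z \<in> (\<Inter>\<theta>\<in>{1..m+1}. H \<theta>)" using z by (auto simp: H_def)
  ultimately obtain e where e: "0 < e" "ball z e \<subseteq> (\<Inter>\<theta>\<in>{1..m+1}. H \<theta>)"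
    by (meson open_contains_ball)
  define P where "P \<theta> y = exp (h \<theta> * (Ln (linear_form (\<nu> \<theta>) z)
      + Ln (linear_form (\<nu> \<theta>) y / linear_form (\<nu> \<theta>) z)))" for \<theta> y
  have "power_branch_on (ball z e) (linear_form (\<nu> \<theta>)) (h \<theta>) (P \<theta>)" if "\<theta> \<in> {1..m+1}" for \<theta>
    unfolding P_def
  proof (rule power_branch_exists_near)
    show "linear_form (\<nu> \<theta>) z \<noteq> 0" using z that by blast
    show "0 < Re (linear_form (\<nu> \<theta>) y / linear_form (\<nu> \<theta>) z)" if "y \<in> ball z e" for y
    proof -
      have "y \<in> H \<theta>" using e(2) \<open>y \<in> ball z e\<close> \<open>\<theta> \<in> {1..m+1}\<close> by blast
      then show ?thesis by (simp add: H_def)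
    qed
  qed (rule continuous_on_linear_form)
  then have "power_product_on m (ball z e) \<nu> h (\<lambda>y. \<Prod>\<theta>=1..m+1. P \<theta> y)"
    unfolding power_product_on_def by blast
  moreover have "domain_set (ball z e)" using e(1) by (simp add: domain_set_def)
  ultimately show ?thesis by blast
qed

text \<open>
  The function \<open>F\<close> is prescribed on \<open>D\<close> only, and \<open>D\<close> need not be open; derivatives are determined
  by the product at the points of an open subset.
\<close>

lemma power_product_eigenfunction:
  assumes "power_product_on m D \<nu> h F" "open \<Omega>" "\<Omega> \<subseteq> D" "z \<in> \<Omega>"
  shows "F differentiable (at z)"
    and "(\<And>\<theta>. \<theta> \<in> {1..m+1} \<Longrightarrow> coeff_matrix a j *v \<nu> \<theta> = c \<theta> *s \<nu> \<theta>) \<Longrightarrow>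
      diff_op a j F z = (\<Sum>\<theta>=1..m+1. c \<theta> * h \<theta>) * F z"
proof -
  obtain P where P: "\<forall>\<theta>\<in>{1..m+1}. power_branch_on D (linear_form (\<nu> \<theta>)) (h \<theta>) (P \<theta>)"
    and F: "\<forall>z\<in>D. F z = (\<Prod>\<theta>=1..m+1. P \<theta> z)"
    using assms(1) by (auto simp: power_product_on_def)
  have F_\<Omega>: "F y = (\<Prod>\<theta>=1..m+1. P \<theta> y)" if "y \<in> \<Omega>" for y using F assms(3) that by blast
  have "power_branch_on \<Omega> (linear_form (\<nu> \<theta>)) (h \<theta>) (P \<theta>)" if "\<theta> \<in> {1..m+1}" for \<theta>
    using P that assms(3) unfolding power_branch_on_def by (meson continuous_on_subset subsetD)
  note branch = diff_op_power_branch[OF this assms(2,4) continuous_on_linear_form]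
  have form: "linear_form (\<nu> \<theta>) differentiable (at z)" for \<theta>
    using linear_form_has_derivative differentiable_def by blast
  have P_differentiable: "P \<theta> differentiable (at z)" if "\<theta> \<in> {1..m+1}" for \<theta>
    by (rule branch(1)[OF that form])
  have prod: "(\<lambda>y. \<Prod>\<theta>=1..m+1. P \<theta> y) differentiable (at z)"
    by (intro differentiable_prod P_differentiable)
  show "F differentiable (at z)" by (rule diff_op_local(1)[OF assms(2,4) F_\<Omega> prod])
  assume eigen: "\<And>\<theta>. \<theta> \<in> {1..m+1} \<Longrightarrow> coeff_matrix a j *v \<nu> \<theta> = c \<theta> *s \<nu> \<theta>"
  have "diff_op a j (P \<theta>) z = (c \<theta> * h \<theta>) * P \<theta> z" if "\<theta> \<in> {1..m+1}" for \<theta>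
    by (rule branch(2)[OF that form diff_op_linear_form_eigenvector[OF eigen[OF that]]])
  then have "diff_op a j (\<lambda>y. \<Prod>\<theta>=1..m+1. P \<theta> y) z
      = (\<Sum>\<theta>=1..m+1. c \<theta> * h \<theta>) * (\<Prod>\<theta>=1..m+1. P \<theta> z)"
    by (intro diff_op_prod_eigenfunctions finite_atLeastAtMost P_differentiable)
  then show "diff_op a j F z = (\<Sum>\<theta>=1..m+1. c \<theta> * h \<theta>) * F z"
    by (simp only: diff_op_local(2)[OF assms(2,4) F_\<Omega> prod] F_\<Omega>[OF assms(4)])
qed

theorem theorem2p10:
  fixes m :: nat
    and a :: "nat \<Rightarrow> 'n::finite + 'n \<Rightarrow> 'n + 'n \<Rightarrow> complex"
    and \<nu> :: "nat \<Rightarrow> complex ^ ('n + 'n)"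
    and lam :: "nat \<Rightarrow> nat \<Rightarrow> complex"
  assumes "jacobian_system m a"
    and "\<forall>\<theta>\<in>{1..m+1}. common_eigenvector m a (\<nu> \<theta>) (lam \<theta>)"
  shows "(\<exists>h. nontrivial_solution m lam h) \<and>
    (\<forall>h. nontrivial_solution m lam h \<longrightarrow>
       (\<exists>F D \<Omega>. power_product_on m D \<nu> h F \<and> domain_set \<Omega> \<and> \<Omega> \<subseteq> D) \<and>
       (\<forall>F D \<Omega>. power_product_on m D \<nu> h F \<and> domain_set \<Omega> \<and> \<Omega> \<subseteq> D \<longrightarrow>
          first_integral m a \<Omega> F))"
proof (intro conjI allI impI)
  show "\<exists>h. nontrivial_solution m lam h"
    using underdetermined_system_has_nontrivial_solution[of "{1..m+1}" m "\<lambda>j \<theta>. lam \<theta> j"]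
    by (simp add: nontrivial_solution_def)
next
  fix h
  have "\<nu> \<theta> \<noteq> 0" if "\<theta> \<in> {1..m+1}" for \<theta>
    using assms(2) that by (auto simp: common_eigenvector_def)
  then show "\<exists>F D \<Omega>. power_product_on m D \<nu> h F \<and> domain_set \<Omega> \<and> \<Omega> \<subseteq> D"
    using power_product_exists[of m \<nu> h] by blast
next
  fix h F D \<Omega>
  assume h: "nontrivial_solution m lam h"
    and F: "power_product_on m D \<nu> h F \<and> domain_set \<Omega> \<and> \<Omega> \<subseteq> D"
  show "first_integral m a \<Omega> F"
    unfolding first_integral_def
  proof (intro conjI ballI)
    fix z assume "z \<in> \<Omega>"
    with F show "F differentiable (at z)"
      by (intro power_product_eigenfunction(1)[of m D \<nu> h F \<Omega>]) (auto simp: domain_set_def)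
  next
    fix j z assume j: "j \<in> {1..m}" and z: "z \<in> \<Omega>"
    have "coeff_matrix a j *v \<nu> \<theta> = lam \<theta> j *s \<nu> \<theta>" if "\<theta> \<in> {1..m+1}" for \<theta>
      using assms(2) j that by (auto simp: common_eigenvector_def)
    then have "diff_op a j F z = (\<Sum>\<theta>=1..m+1. lam \<theta> j * h \<theta>) * F z"
      using F z by (intro power_product_eigenfunction(2)[of m D \<nu> h F \<Omega>])
        (auto simp: domain_set_def)
    then show "diff_op a j F z = 0"
      using h j by (simp add: nontrivial_solution_def)
  qed
qed

end
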